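(* For any graph $D$ on $n$ vertices (loops allowed) and any integer $q \ge 2$, $$\frac{1}{|\mathrm{F}[D,q]|} \sum_{f \in \mathrm{F}[D,q]} \mathrm{s}(f) \le \frac{n}{q}.$$
   Context: Graphs are finite and directed: $D=(V,E)$ with $V=\{1,\dots,n\}$, $n\ge1$, $E\subseteq V^2$. For an integer $q\ge2$ let $[q]=\{0,\dots,q-1\}$. For $f=(f_1,\dots,f_n):[q]^n\to[q]^n$, the interaction graph $G(f)$ has vertex set $V$ and an arc $(u,v)$ if and only if there exist $x,y\in[q]^n$ differing only in coordinate $u$ with $f_v(x)\ne f_v(y)$. $\mathrm{F}[D,q]$ is the set of all $f:[q]^n\to[q]^n$ with $G(f)=D$. With $d_{\mathrm H}$ the Hamming distance, $\mathrm{s}(f)=\min_{x\in[q]^n}(n-d_{\mathrm H}(x,f(x)))$. *)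

theory Defs
  imports
    "HOL-Library.FuncSet"
    "HOL.Real"
    "Graph_Theory.Pair_Digraph"
begin

text \<open>
  Configurations and maps are extensional functions, i.e. they take the value
  \<^term>\<open>undefined\<close> outside their domain. So distinct HOL functions represent
  distinct mathematical ones, and cardinalities and sums over sets of them are the
  intended ones.
\<close>

definition configs :: "nat \<Rightarrow> nat \<Rightarrow> (nat \<Rightarrow> nat) set" where
  "configs n q = {1..n} \<rightarrow>\<^sub>E {0..<q}"

definition differing :: "nat \<Rightarrow> (nat \<Rightarrow> nat) \<Rightarrow> (nat \<Rightarrow> nat) \<Rightarrow> nat set" where
  "differing n x y = {i \<in> {1..n}. x i \<noteq> y i}"

definition hamming_dist :: "nat \<Rightarrow> (nat \<Rightarrow> nat) \<Rightarrow> (nat \<Rightarrow> nat) \<Rightarrow> nat" where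
  "hamming_dist n x y = card (differing n x y)"

definition interaction_graph ::
  "nat \<Rightarrow> nat \<Rightarrow> ((nat \<Rightarrow> nat) \<Rightarrow> (nat \<Rightarrow> nat)) \<Rightarrow> nat pair_pre_digraph" where
  "interaction_graph n q f =
    \<lparr> pverts = {1..n},
      parcs = {(u, v) \<in> {1..n} \<times> {1..n}.
        \<exists>x \<in> configs n q. \<exists>y \<in> configs n q. differing n x y = {u} \<and> f x v \<noteq> f y v} \<rparr>"

text \<open>The set \<open>F[D,q]\<close>, for a digraph \<open>D\<close> with vertex set \<open>{1..n}\<close>.\<close>

definition maps_on_graph ::
  "nat \<Rightarrow> nat \<Rightarrow> nat pair_pre_digraph \<Rightarrow> ((nat \<Rightarrow> nat) \<Rightarrow> (nat \<Rightarrow> nat)) set" where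
  "maps_on_graph n q D =
    {f \<in> configs n q \<rightarrow>\<^sub>E configs n q. interaction_graph n q f = D}"

text \<open>
  The subtraction on \<^typ>\<open>nat\<close> below never truncates, since
  \<^term>\<open>hamming_dist n x y \<le> n\<close> for all \<open>x\<close> and \<open>y\<close>.
\<close>

definition stability :: "nat \<Rightarrow> nat \<Rightarrow> ((nat \<Rightarrow> nat) \<Rightarrow> (nat \<Rightarrow> nat)) \<Rightarrow> nat" where
  "stability n q f = Min ((\<lambda>x. n - hamming_dist n x (f x)) ` configs n q)"

end

(* For a fixed configuration x, the stability of f is at most the number of coordinates v with
   f x v = x v.  Composing the local function at v with a permutation of the alphabet preserves
   the interaction graph, so the value f x v is equidistributed as f ranges over F[D,q], and
   each coordinate contributes 1/q to the average. *)
theory Submission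
  imports Defs "HOL-Combinatorics.Transposition"
begin

text \<open>The restriction keeps the result extensional, so that it can lie in
  \<open>maps_on_graph n q D\<close> and relabelling twice by an involution returns \<open>f\<close>
  itself, not just a map agreeing with it on \<open>configs n q\<close>.\<close>

definition relabel ::
  "nat \<Rightarrow> nat \<Rightarrow> nat \<Rightarrow> (nat \<Rightarrow> nat) \<Rightarrow> ((nat \<Rightarrow> nat) \<Rightarrow> (nat \<Rightarrow> nat)) \<Rightarrow> ((nat \<Rightarrow> nat) \<Rightarrow> (nat \<Rightarrow> nat))" where
  "relabel n q v \<pi> f = restrict (\<lambda>x. (f x)(v := \<pi> (f x v))) (configs n q)"

lemma finite_configs: "finite (configs n q)"
  by (simp add: configs_def finite_PiE)

lemma finite_maps_on_graph: "finite (maps_on_graph n q D)"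
  by (simp add: maps_on_graph_def finite_PiE finite_configs)

text \<open>An injective \<pi> neither merges nor splits values, so two configurations are separated
  by the local function at \<open>v\<close> before relabelling exactly when they are afterwards; the
  other local functions are untouched.\<close>

lemma interaction_graph_relabel:
  assumes "inj \<pi>"
  shows "interaction_graph n q (relabel n q v \<pi> f) = interaction_graph n q f"
proof -
  have "relabel n q v \<pi> f x w \<noteq> relabel n q v \<pi> f y w \<longleftrightarrow> f x w \<noteq> f y w"
    if "x \<in> configs n q" "y \<in> configs n q" for x y w
    using that inj_eq[OF assms] by (simp add: relabel_def)
  then show ?thesis
    unfolding interaction_graph_def by (simp cong: bex_cong conj_cong)
qed

lemma relabel_in_maps_on_graph:
  assumes "f \<in> maps_on_graph n q D" "v \<in> {1..n}" "inj \<pi>" "\<And>a. a < q \<Longrightarrow> \<pi> a < q"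
  shows "relabel n q v \<pi> f \<in> maps_on_graph n q D"
proof -
  have f: "f x \<in> configs n q" if "x \<in> configs n q" for x
    using assms(1) that by (auto simp: maps_on_graph_def)
  have "(f x)(v := \<pi> (f x v)) \<in> configs n q" if "x \<in> configs n q" for x
    using f[OF that] assms(2,4) by (auto simp: configs_def PiE_iff extensional_def)
  then have "relabel n q v \<pi> f \<in> configs n q \<rightarrow>\<^sub>E configs n q"
    by (simp add: relabel_def)
  then show ?thesis
    using assms(1) interaction_graph_relabel[OF assms(3)] by (simp add: maps_on_graph_def)
qed

lemma relabel_involution:
  assumes "f \<in> maps_on_graph n q D" "\<And>a. \<pi> (\<pi> a) = a"
  shows "relabel n q v \<pi> (relabel n q v \<pi> f) = f"
  using assms by (auto simp: relabel_def maps_on_graph_def PiE_iff extensional_def fun_eq_iff)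

text \<open>Relabelling by the transposition of \<open>a\<close> and \<open>b\<close> swaps the two
  fibres and is its own inverse. As \<open>a\<close> and \<open>b\<close> are below
  \<open>q\<close>, the transposition also preserves the alphabet.\<close>

lemma card_value_eq:
  assumes "x \<in> configs n q" "v \<in> {1..n}" "a < q" "b < q"
  shows "card {f \<in> maps_on_graph n q D. f x v = a} = card {f \<in> maps_on_graph n q D. f x v = b}"
proof (rule bij_betw_same_card)
  let ?T = "relabel n q v (transpose a b)"
  have T: "?T f \<in> maps_on_graph n q D" if "f \<in> maps_on_graph n q D" for f
    using that assms by (intro relabel_in_maps_on_graph) (auto simp: transpose_def)
  have val: "?T f x v = transpose a b (f x v)" for f
    using assms(1) by (simp add: relabel_def)
  show "bij_betw ?T {f \<in> maps_on_graph n q D. f x v = a} {f \<in> maps_on_graph n q D. f x v = b}"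
    by (rule bij_betw_byWitness[where f' = ?T]) (simp_all add: T val relabel_involution[of _ n q D] image_subset_iff)
qed

text \<open>The fibres over the \<open>q\<close> possible values partition
  \<open>maps_on_graph n q D\<close> and are all equally large. The product form avoids division on
  the naturals.\<close>

lemma card_value:
  assumes "x \<in> configs n q" "v \<in> {1..n}" "a < q"
  shows "q * card {f \<in> maps_on_graph n q D. f x v = a} = card (maps_on_graph n q D)"
proof -
  let ?F = "\<lambda>b. {f \<in> maps_on_graph n q D. f x v = b}"
  have "f x v < q" if "f \<in> maps_on_graph n q D" for f
  proof -
    have "f x \<in> configs n q"
      using that assms(1) by (auto simp: maps_on_graph_def)
    with assms(2) show ?thesis
      by (auto simp: configs_def)
  qed
  then have "maps_on_graph n q D = (\<Union>b<q. ?F b)"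
    by auto
  then have "card (maps_on_graph n q D) = card (\<Union>b<q. ?F b)"
    by (rule arg_cong)
  also have "\<dots> = (\<Sum>b<q. card (?F b))"
    by (rule card_UN_disjoint) (auto simp: finite_maps_on_graph)
  also have "\<dots> = (\<Sum>b<q. card (?F a))"
    using card_value_eq[OF assms(1,2) _ assms(3)] by (intro sum.cong) auto
  finally show ?thesis
    by simp
qed

text \<open>The minimum is at most its term at \<open>x\<close>, which counts the coordinates where
  \<open>x\<close> and \<open>f x\<close> agree.\<close>

lemma stability_le:
  assumes "x \<in> configs n q"
  shows "stability n q f \<le> card {v \<in> {1..n}. f x v = x v}"
proof -
  have "stability n q f \<le> n - hamming_dist n x (f x)"
    unfolding stability_def using assms finite_configs by (intro Min_le) auto
  also have "\<dots> = card ({1..n} - differing n x (f x))"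
    by (subst card_Diff_subset) (auto simp: hamming_dist_def differing_def)
  also have "{1..n} - differing n x (f x) = {v \<in> {1..n}. f x v = x v}"
    by (auto simp: differing_def)
  finally show ?thesis .
qed

lemma sum_stability_le:
  assumes "q \<ge> 1"
  shows "q * (\<Sum>f \<in> maps_on_graph n q D. stability n q f) \<le> n * card (maps_on_graph n q D)"
proof -
  let ?F = "maps_on_graph n q D"
  \<comment> \<open>Any configuration serves, provided that the same one is used for every
    \<open>f\<close>; the constant 0 is available because \<open>q\<close> is positive.\<close>
  obtain x where x: "x \<in> configs n q"
    using assms that[of "\<lambda>i\<in>{1..n}. 0"] by (auto simp: configs_def)
  have "(\<Sum>f\<in>?F. stability n q f) \<le> (\<Sum>f\<in>?F. card {v \<in> {1..n}. f x v = x v})"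
    by (intro sum_mono stability_le x)
  \<comment> \<open>Double counting of the pairs of a map \<open>f\<close> and a coordinate
    \<open>v\<close> fixed by \<open>f\<close> at \<open>x\<close>.\<close>
  also have "\<dots> = (\<Sum>v\<in>{1..n}. card {f \<in> ?F. f x v = x v})"
    by (rule sum_multicount_gen) (auto simp: finite_maps_on_graph)
  finally have "q * (\<Sum>f\<in>?F. stability n q f) \<le> (\<Sum>v\<in>{1..n}. q * card {f \<in> ?F. f x v = x v})"
    by (simp add: sum_distrib_left[symmetric])
  \<comment> \<open>Equidistribution is applied at each \<open>v\<close> with the value
    \<open>a = x v\<close>.\<close>
  also have "\<dots> = (\<Sum>v\<in>{1..n}. card ?F)"
    using x by (intro sum.cong card_value) (auto simp: configs_def)
  finally show ?thesis
    by simp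
qed

theorem proposition4p1:
  fixes n q :: nat and D :: "nat pair_pre_digraph"
  assumes "n \<ge> 1"
    and "q \<ge> 2"
    and "pair_fin_digraph D"
    and "pverts D = {1..n}"
  shows "1 / real (card (maps_on_graph n q D)) *
           (\<Sum>f \<in> maps_on_graph n q D. real (stability n q f))
         \<le> real n / real q"
proof (cases "card (maps_on_graph n q D) = 0")
  case False
  have "q * (\<Sum>f \<in> maps_on_graph n q D. stability n q f) \<le> n * card (maps_on_graph n q D)"
    using assms(2) by (intro sum_stability_le) simp
  then have "real q * (\<Sum>f \<in> maps_on_graph n q D. real (stability n q f))
      \<le> real n * real (card (maps_on_graph n q D))"
    by (metis of_nat_le_iff of_nat_mult of_nat_sum)
  with False assms(2) show ?thesis
    by (simp add: field_simps)
\<comment> \<open>In the remaining case the cardinality is 0, and the left side vanishes because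
  \<open>1 / 0 = 0\<close> in HOL.\<close>
qed simp

end
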